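(* Let $m\geq 2$ and $R\cong \prod_{i=1}^{m}R_{i}$, where each $R_i$ is a local principal ideal ring with finitely many ideals that is not a field, and let $n_i$ be the number of non-trivial (nonzero proper) ideals of $R_i$. Then $sdim(G(R))=\prod_{i=1}^{m}(n_{i}+2)-2^{m-1}-2$.
   Context: All rings are commutative with identity. $I(R)$ is the set of non-trivial (nonzero proper) ideals of $R$; $G(R)$ is the graph with vertex set $I(R)$ in which distinct $I,J$ are adjacent iff $I\cap J\neq 0$. For a graph $G$ with distance $d$, two vertices $u,v$ are strongly resolved by a vertex $w$ if $d(w,u)=d(w,v)+d(v,u)$ or $d(w,v)=d(w,u)+d(u,v)$. A set $W$ of vertices is a strong resolving set if every two distinct vertices are strongly resolved by some vertex of $W$; $sdim(G)$ is the minimum cardinality of a strong resolving set. *)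

theory Defs
  imports "HOL-Algebra.Chinese_Remainder" "Graph_Theory.Shortest_Path"
begin

definition local_ring :: "('a, 'b) ring_scheme \<Rightarrow> bool" where
  "local_ring R \<longleftrightarrow> cring R \<and> (\<exists>!M. maximalideal M R)"

definition principal_ideal_ring :: "('a, 'b) ring_scheme \<Rightarrow> bool" where
  "principal_ideal_ring R \<longleftrightarrow> cring R \<and> (\<forall>I. ideal I R \<longrightarrow> principalideal I R)"

definition nontrivial_ideals :: "('a, 'b) ring_scheme \<Rightarrow> 'a set set" where
  "nontrivial_ideals R = {I. ideal I R \<and> I \<noteq> {\<zero>\<^bsub>R\<^esub>} \<and> I \<noteq> carrier R}"

text \<open>An undirected simple graph is represented, as usual in the digraph library, by the
  symmetric loop-free digraph containing both orientations of every edge.\<close>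

definition intersection_graph ::
    "('a, 'b) ring_scheme \<Rightarrow> ('a set, 'a set \<times> 'a set) pre_digraph" where
  "intersection_graph R =
    \<lparr> verts = nontrivial_ideals R,
      arcs = {(I, J). I \<in> nontrivial_ideals R \<and> J \<in> nontrivial_ideals R \<and>
                      I \<noteq> J \<and> I \<inter> J \<noteq> {\<zero>\<^bsub>R\<^esub>}},
      tail = fst, head = snd \<rparr>"

lemma wf_digraph_intersection_graph: "wf_digraph (intersection_graph R)"
  by unfold_locales (auto simp: intersection_graph_def)

lemma loopfree_digraph_intersection_graph: "loopfree_digraph (intersection_graph R)"
  by (intro loopfree_digraph.intro loopfree_digraph_axioms.intro wf_digraph_intersection_graph)
    (auto simp: intersection_graph_def)

lemma sym_digraph_intersection_graph: "sym_digraph (intersection_graph R)"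
  by (intro sym_digraph.intro sym_digraph_axioms.intro wf_digraph_intersection_graph)
    (auto simp: intersection_graph_def symmetric_conv)

text \<open>With all arcs of weight 1, the cost of a walk is its length, so the infimum over all walks
  is the usual graph distance (with value \<open>\<infinity>\<close> if there is no walk).\<close>

definition graph_dist :: "('a, 'b) pre_digraph \<Rightarrow> 'a \<Rightarrow> 'a \<Rightarrow> ereal" where
  "graph_dist G u v = wf_digraph.\<mu> G (\<lambda>_. 1) u v"

definition strongly_resolves :: "('a, 'b) pre_digraph \<Rightarrow> 'a \<Rightarrow> 'a \<Rightarrow> 'a \<Rightarrow> bool" where
  "strongly_resolves G w u v \<longleftrightarrow>
     graph_dist G w u = graph_dist G w v + graph_dist G v u \<or>
     graph_dist G w v = graph_dist G w u + graph_dist G u v"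

definition strong_resolving_set :: "('a, 'b) pre_digraph \<Rightarrow> 'a set \<Rightarrow> bool" where
  "strong_resolving_set G W \<longleftrightarrow> W \<subseteq> verts G \<and>
     (\<forall>u\<in>verts G. \<forall>v\<in>verts G. u \<noteq> v \<longrightarrow> (\<exists>w\<in>W. strongly_resolves G w u v))"

text \<open>The value is meaningful for graphs having a finite strong resolving set, in particular for
  all finite graphs; finiteness is demanded because \<open>card\<close> is 0 on infinite sets.\<close>

definition sdim :: "('a, 'b) pre_digraph \<Rightarrow> nat" where
  "sdim G = (LEAST k. \<exists>W. strong_resolving_set G W \<and> finite W \<and> card W = k)"

end

theory Submission
  imports Defs
begin

text \<open>
  Send an ideal of \<open>R\<close> to its support, the set of factors in which its component is nonzero. Two
  ideals of a local principal ideal ring with finitely many ideals are comparable, so nonzero ones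
  meet, and ideals of \<open>R\<close> meet exactly when their supports do. Hence the graph has diameter at most
  \<open>2\<close>, and a third vertex can strongly resolve \<open>u\<close> and \<open>v\<close> only if their supports are distinct and
  meet. So \<open>W\<close> is strongly resolving iff the vertices outside \<open>W\<close> have distinct, pairwise
  intersecting supports; the largest intersecting family of subsets of an \<open>m\<close>-set has \<open>2 ^ (m - 1)\<close>
  members.
\<close>

section \<open>Shortest walks and intersecting families of sets\<close>

lemma (in wf_digraph) awalk_cost_one: "awalk_cost (\<lambda>_. 1) p = real (length p)"
  by (induction p) auto

text \<open>With unit weights the cost of a walk is its length, so a shortest walk attains the
  infimum that defines the distance.\<close>

lemma (in wf_digraph) graph_dist_eqI:
  assumes "awalk u p v" and "\<And>q. awalk u q v \<Longrightarrow> length p \<le> length q"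
  shows "graph_dist G u v = ereal (real (length p))"
  unfolding graph_dist_def \<mu>_def awalk_cost_one
  using assms by (intro antisym INF_lower2[of p] INF_greatest) auto

text \<open>The complements of the members form a family of the same size, and it is disjoint from
  \<open>F\<close>: a set and its complement never meet. Hence \<open>F\<close> takes up at most
  half of the power set.\<close>

lemma card_intersecting_family_le:
  assumes "finite A" and "A \<noteq> {}" and "F \<subseteq> Pow A"
    and meet: "\<And>B C. B \<in> F \<Longrightarrow> C \<in> F \<Longrightarrow> B \<inter> C \<noteq> {}"
  shows "card F \<le> 2 ^ (card A - 1)"
proof -
  let ?F' = "(\<lambda>B. A - B) ` F"
  have "finite F" using assms finite_subset by blast
  have "inj_on (\<lambda>B. A - B) F"
    using \<open>F \<subseteq> Pow A\<close> by (intro inj_onI) blast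
  then have "card ?F' = card F" by (rule card_image)
  moreover have "F \<inter> ?F' = {}" using meet by fastforce
  ultimately have "2 * card F = card (F \<union> ?F')"
    using \<open>finite F\<close> by (simp add: card_Un_disjoint)
  also have "\<dots> \<le> card (Pow A)"
    using assms by (intro card_mono) auto
  also have "\<dots> = 2 * 2 ^ (card A - 1)"
    using assms by (cases "card A") (auto simp: card_Pow)
  finally show ?thesis by simp
qed

text \<open>The star at a point is an intersecting family, and this count shows that it attains the
  preceding bound.\<close>

lemma card_subsets_containing:
  assumes "finite A" and "i \<in> A"
  shows "card {B. B \<subseteq> A \<and> i \<in> B} = 2 ^ (card A - 1)"
proof -
  have "{B. B \<subseteq> A \<and> i \<in> B} = insert i ` Pow (A - {i})"
  proof (intro equalityI subsetI)
    fix B assume "B \<in> {B. B \<subseteq> A \<and> i \<in> B}"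
    then show "B \<in> insert i ` Pow (A - {i})"
      by (intro image_eqI[where x = "B - {i}"]) auto
  qed (use assms in auto)
  moreover have "inj_on (insert i) (Pow (A - {i}))"
    by (intro inj_onI) blast
  ultimately show ?thesis
    using assms by (simp add: card_image card_Pow)
qed

section \<open>Strong metric dimension of graphs in which adjacency means that supports meet\<close>

locale support_graph =
  fixes G :: "('a, 'a \<times> 'a) pre_digraph" and supp :: "'a \<Rightarrow> 'i set" and A :: "'i set"
  assumes finite_index: "finite A" and index_nonempty: "A \<noteq> {}"
    and finite_verts: "finite (verts G)"
    and arcs_eq: "arcs G = {(u, v). u \<in> verts G \<and> v \<in> verts G \<and> u \<noteq> v \<and> supp u \<inter> supp v \<noteq> {}}"
    and tail_eq: "tail G = fst" and head_eq: "head G = snd"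
    and supp_subset: "u \<in> verts G \<Longrightarrow> supp u \<subseteq> A"
    and supp_nonempty: "u \<in> verts G \<Longrightarrow> supp u \<noteq> {}"
    and supp_surj: "B \<subseteq> A \<Longrightarrow> B \<noteq> {} \<Longrightarrow> \<exists>u\<in>verts G. supp u = B"
    and supp_singleton: "i \<in> A \<Longrightarrow>
      \<exists>u\<in>verts G. \<exists>v\<in>verts G. u \<noteq> v \<and> supp u = {i} \<and> supp v = {i}"
begin

lemma wf_digraph_G: "wf_digraph G"
  by unfold_locales (auto simp: arcs_eq tail_eq head_eq)

lemma graph_dist_support:
  assumes "u \<in> verts G" and "v \<in> verts G"
  shows "graph_dist G u v = (if u = v then 0 else if supp u \<inter> supp v \<noteq> {} then 1 else 2)"
proof -
  interpret wf_digraph G by (rule wf_digraph_G)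
  have nonempty_walk: "q \<noteq> []" if "awalk u q v" "u \<noteq> v" for q
    using that by (auto simp: awalk_Nil_iff)
  consider "u = v" | "u \<noteq> v" "supp u \<inter> supp v \<noteq> {}" | "u \<noteq> v" "supp u \<inter> supp v = {}"
    by blast
  then show ?thesis
  proof cases
    case 1
    have "graph_dist G u v = ereal (real (length ([] :: ('a \<times> 'a) list)))"
      using assms 1 by (intro graph_dist_eqI) (auto simp: awalk_Nil_iff)
    with 1 show ?thesis by (simp add: zero_ereal_def)
  next
    case 2
    have "graph_dist G u v = ereal (real (length [(u, v)]))"
      using assms 2 nonempty_walk
      by (intro graph_dist_eqI)
        (auto simp: awalk_simps arcs_eq tail_eq head_eq Suc_le_eq)
    with 2 show ?thesis by (simp add: one_ereal_def)
  next
    case 3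
    \<comment> \<open>A vertex of full support meets every vertex. It differs from \<open>u\<close>
      and \<open>v\<close>, whose supports are disjoint, so it is a common neighbour and bounds the
      distance by 2.\<close>
    obtain w where w: "w \<in> verts G" "supp w = A"
      using supp_surj[of A] index_nonempty by auto
    have meets: "supp w \<inter> supp u \<noteq> {}" "supp w \<inter> supp v \<noteq> {}"
      using w assms supp_subset supp_nonempty by blast+
    have "graph_dist G u v = ereal (real (length [(u, w), (w, v)]))"
    proof (intro graph_dist_eqI)
      show "awalk u [(u, w), (w, v)] v"
        using assms 3 w meets by (auto simp: awalk_simps arcs_eq tail_eq head_eq)
      show "length [(u, w), (w, v)] \<le> length q" if "awalk u q v" for q
      proof (cases q)
        case Nil
        with that 3 nonempty_walk show ?thesis by blast
      next
        \<comment> \<open>A walk of length one would be an arc from \<open>u\<close> to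
          \<open>v\<close>, and the supports would meet.\<close>
        case (Cons e es)
        with that 3 show ?thesis
          by (cases es) (auto simp: awalk_simps arcs_eq tail_eq head_eq)
      qed
    qed
    with 3 show ?thesis by simp
  qed
qed

text \<open>Distances between distinct vertices are 1 or 2. For \<open>w\<close> other than
  \<open>u\<close> and \<open>v\<close> both summands in the resolving equation are at least 1, so
  it can only read 2 = 1 + 1. Thus \<open>u\<close> and \<open>v\<close> are adjacent and
  \<open>w\<close> is adjacent to exactly one of them.\<close>

lemma strongly_resolves_iff:
  assumes "u \<in> verts G" "v \<in> verts G" "w \<in> verts G" and "u \<noteq> v"
  shows "strongly_resolves G w u v \<longleftrightarrow> w = u \<or> w = v \<or>
    (supp u \<inter> supp v \<noteq> {} \<and> (supp w \<inter> supp u = {} \<longleftrightarrow> supp w \<inter> supp v \<noteq> {}))"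
  using assms unfolding strongly_resolves_def
  by (auto simp: graph_dist_support Int_commute)

text \<open>A pair with a member in \<open>W\<close> is resolved by that member. For any other pair
  the resolver is a third vertex, which tells the two supports apart; conversely, vertices with
  singleton support serve as resolvers.\<close>

lemma strong_resolving_set_iff:
  "strong_resolving_set G W \<longleftrightarrow> W \<subseteq> verts G \<and>
     (\<forall>u\<in>verts G - W. \<forall>v\<in>verts G - W. u \<noteq> v \<longrightarrow> supp u \<noteq> supp v \<and> supp u \<inter> supp v \<noteq> {})"
  (is "_ \<longleftrightarrow> _ \<and> ?separated")
proof safe
  assume W: "strong_resolving_set G W"
  then show "x \<in> verts G" if "x \<in> W" for x
    using that by (auto simp: strong_resolving_set_def)
  fix u v assume uv: "u \<in> verts G" "u \<notin> W" "v \<in> verts G" "v \<notin> W" "u \<noteq> v"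
  with W obtain w where w: "w \<in> W" "w \<in> verts G" "strongly_resolves G w u v"
    unfolding strong_resolving_set_def by blast
  have "w \<noteq> u" "w \<noteq> v" using w uv by auto
  then have *: "supp u \<inter> supp v \<noteq> {} \<and> (supp w \<inter> supp u = {} \<longleftrightarrow> supp w \<inter> supp v \<noteq> {})"
    using strongly_resolves_iff uv w by blast
  show False if "supp u = supp v" using * that by auto
  show False if "supp u \<inter> supp v = {}" using * that by auto
next
  assume W: "W \<subseteq> verts G" and sep: ?separated
  have resolve: "\<exists>w\<in>W. strongly_resolves G w u v"
    if uv: "u \<in> verts G" "v \<in> verts G" "u \<noteq> v" for u v
  proof (cases "u \<in> W \<or> v \<in> W")
    case True
    then show ?thesis using uv strongly_resolves_iff by blast
  next
    case False
    with sep uv have meet: "supp u \<noteq> supp v" "supp u \<inter> supp v \<noteq> {}" by blast+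
    \<comment> \<open>A support \<open>{i}\<close> with \<open>i\<close> in the symmetric difference
      meets exactly one of the two supports, so a vertex carrying it resolves the pair.\<close>
    then obtain i where i: "i \<in> supp u \<union> supp v" "i \<notin> supp u \<inter> supp v" by blast
    \<comment> \<open>Two vertices of the same support cannot both be missing from \<open>W\<close>.\<close>
    have "i \<in> A" using i uv supp_subset by blast
    then obtain w where w: "w \<in> W" "supp w = {i}"
      using supp_singleton[of i] sep by (metis DiffI)
    then have "strongly_resolves G w u v"
      using strongly_resolves_iff[of u v w] uv meet i W by auto
    then show ?thesis using w by blast
  qed
  show "strong_resolving_set G W"
    unfolding strong_resolving_set_def using W resolve by blast
qed

text \<open>The complement of a strong resolving set is mapped injectively by \<open>supp\<close>
  onto an intersecting family, which bounds its size; a star attains the bound. The additive form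
  avoids truncated subtraction.\<close>

lemma sdim_support_graph: "sdim G + 2 ^ (card A - 1) = card (verts G)"
proof -
  obtain i where i: "i \<in> A" using index_nonempty by blast
  let ?F = "{B. B \<subseteq> A \<and> i \<in> B}"
  have "\<forall>B\<in>?F. \<exists>u\<in>verts G. supp u = B" using supp_surj by blast
  \<comment> \<open>One vertex is chosen for each set of the star, and these are the vertices left
    out of the resolving set. The choice is injective because \<open>supp\<close> inverts
    it.\<close>
  then obtain r where r: "\<And>B. B \<in> ?F \<Longrightarrow> r B \<in> verts G \<and> supp (r B) = B"
    by metis
  have "card (r ` ?F) = 2 ^ (card A - 1)"
    using card_image[OF inj_on_inverseI[of ?F supp r]] r card_subsets_containing[OF finite_index i]
    by simp
  moreover have subset: "r ` ?F \<subseteq> verts G" using r by blast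
  ultimately have card_W: "card (verts G - r ` ?F) = card (verts G) - 2 ^ (card A - 1)"
    and le: "2 ^ (card A - 1) \<le> card (verts G)"
    using finite_verts card_mono[OF finite_verts subset]
    by (simp_all add: card_Diff_subset finite_subset)
  have "strong_resolving_set G (verts G - r ` ?F)"
    unfolding strong_resolving_set_iff
  proof (intro conjI ballI impI)
    fix u v assume "u \<in> verts G - (verts G - r ` ?F)" "v \<in> verts G - (verts G - r ` ?F)" "u \<noteq> v"
    then obtain B C where "B \<in> ?F" "C \<in> ?F" "u = r B" "v = r C" "B \<noteq> C" by blast
    with r[of B] r[of C] show "supp u \<noteq> supp v" "supp u \<inter> supp v \<noteq> {}" by auto
  qed auto
  moreover have "card (verts G) - 2 ^ (card A - 1) \<le> card W" if W: "strong_resolving_set G W" for W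
  proof -
    let ?C = "verts G - W"
    have sub: "W \<subseteq> verts G"
      and sep: "\<And>u v. u \<in> ?C \<Longrightarrow> v \<in> ?C \<Longrightarrow> u \<noteq> v \<Longrightarrow> supp u \<noteq> supp v \<and> supp u \<inter> supp v \<noteq> {}"
      using W unfolding strong_resolving_set_iff by blast+
    have "inj_on supp ?C" using sep by (intro inj_onI) blast
    then have "card ?C = card (supp ` ?C)" by (simp add: card_image)
    also have "\<dots> \<le> 2 ^ (card A - 1)"
    proof (intro card_intersecting_family_le finite_index index_nonempty)
      show "supp ` ?C \<subseteq> Pow A" using supp_subset by blast
      show "B \<inter> C \<noteq> {}" if "B \<in> supp ` ?C" "C \<in> supp ` ?C" for B C
      proof -
        obtain u v where "u \<in> ?C" "v \<in> ?C" "B = supp u" "C = supp v" using \<open>B \<in> _\<close> \<open>C \<in> _\<close> by blast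
        \<comment> \<open>An intersecting family must also have each member meet itself; the case
          \<open>u = v\<close> is settled by nonempty supports.\<close>
        then show ?thesis using sep[of u v] supp_nonempty[of u] by (cases "u = v") auto
      qed
    qed
    finally show ?thesis
      using sub finite_verts by (simp add: card_Diff_subset finite_subset)
  qed
  ultimately have "sdim G = card (verts G) - 2 ^ (card A - 1)"
    unfolding sdim_def using card_W finite_verts by (intro Least_equality) auto
  with le show ?thesis by simp
qed

end

section \<open>Ideals of local principal ideal rings\<close>

lemma (in cring) ideal_in_maximalideal:
  assumes "finite {I. ideal I R}" and "ideal I R" and "I \<noteq> carrier R"
  shows "\<exists>M. maximalideal M R \<and> I \<subseteq> M"
proof -
  let ?P = "{J. ideal J R \<and> J \<noteq> carrier R}"
  have "finite ?P" using assms(1) by (rule rev_finite_subset) blast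
  moreover have "I \<in> ?P" using assms(2,3) by simp
  \<comment> \<open>Finiteness of the set of ideals takes the place of Zorn's lemma.\<close>
  ultimately obtain M where M: "M \<in> ?P" "I \<subseteq> M" "\<forall>J\<in>?P. M \<subseteq> J \<longrightarrow> M = J"
    by (rule finite_has_maximal2[THEN bexE]) simp
  have "maximalideal M R"
    using M by (intro maximalidealI) auto
  with M show ?thesis by blast
qed

text \<open>Let \<open>d\<close> generate the ideal spanned by \<open>a\<close> and
  \<open>b\<close>, with a = s d and b = t d. If \<open>s\<close> or \<open>t\<close> is a unit,
  then \<open>a\<close> or \<open>b\<close> generates the same ideal as \<open>d\<close> and
  contains the other. Otherwise a Nakayama argument forces d = 0.\<close>

lemma (in cring) local_principal_divides:
  assumes "local_ring R" and "principal_ideal_ring R" and fin: "finite {I. ideal I R}"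
    and a: "a \<in> carrier R" and b: "b \<in> carrier R"
  shows "a \<in> PIdl b \<or> b \<in> PIdl a"
proof -
  obtain M where "maximalideal M R" and M_unique: "\<And>N. maximalideal N R \<Longrightarrow> N = M"
    using assms(1) unfolding local_ring_def by blast
  interpret M: maximalideal M R by fact
  \<comment> \<open>A non-unit generates a proper ideal, which lies in some maximal ideal, and
    \<open>M\<close> is the only one.\<close>
  have unit: "\<exists>z\<in>carrier R. z \<otimes> x = \<one>" if x: "x \<in> carrier R" "x \<notin> M" for x
  proof (rule ccontr)
    assume "\<not> ?thesis"
    then have "\<one> \<notin> PIdl x" by (force simp: cgenideal_def)
    then obtain N where "maximalideal N R" "PIdl x \<subseteq> N"
      using ideal_in_maximalideal[OF fin cgenideal_ideal[OF x(1)]] by auto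
    then show False using M_unique cgenideal_self[OF x(1)] x(2) by blast
  qed
  have "principalideal (PIdl a <+> PIdl b) R"
    using assms(2) a b by (simp add: principal_ideal_ring_def add_ideals cgenideal_ideal)
  then obtain d where d: "d \<in> carrier R" "PIdl a <+> PIdl b = PIdl d"
    by (metis principalideal.generate cgenideal_eq_genideal)
  have in_sum: "u \<oplus> v \<in> PIdl a <+> PIdl b" if "u \<in> PIdl a" "v \<in> PIdl b" for u v
    using that unfolding set_add_def' by blast
  have zero: "\<zero> \<in> PIdl a" "\<zero> \<in> PIdl b"
    using a b by (auto intro!: additive_subgroup.zero_closed ideal.axioms(1) cgenideal_ideal)
  have "a \<in> PIdl d" using in_sum[OF cgenideal_self[OF a] zero(2)] a d by simp
  then obtain s where s: "s \<in> carrier R" "a = s \<otimes> d" unfolding cgenideal_def by blast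
  have "b \<in> PIdl d" using in_sum[OF zero(1) cgenideal_self[OF b]] b d by simp
  then obtain t where t: "t \<in> carrier R" "b = t \<otimes> d" unfolding cgenideal_def by blast
  have "d \<in> PIdl a <+> PIdl b" using cgenideal_self d by simp
  then obtain x y where xy: "x \<in> carrier R" "y \<in> carrier R" "d = x \<otimes> a \<oplus> y \<otimes> b"
    unfolding cgenideal_def set_add_def' by auto
  consider "s \<notin> M" | "t \<notin> M" | "s \<in> M" "t \<in> M" by blast
  then show ?thesis
  proof cases
    case 1
    then obtain z where z: "z \<in> carrier R" "z \<otimes> s = \<one>" using unit s by blast
    then have "b = (t \<otimes> z) \<otimes> a" using s t d by (simp add: m_assoc) (simp flip: m_assoc)
    then show ?thesis using z t unfolding cgenideal_def by blast
  next
    case 2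
    then obtain z where z: "z \<in> carrier R" "z \<otimes> t = \<one>" using unit t by blast
    then have "a = (s \<otimes> z) \<otimes> b" using s t d by (simp add: m_assoc) (simp flip: m_assoc)
    then show ?thesis using z s unfolding cgenideal_def by blast
  next
    case 3
    \<comment> \<open>Substituting a = s d and b = t d into d = x a + y b gives d = c d. As
      \<open>c\<close> lies in \<open>M\<close>, the element 1 - c is a unit, and it annihilates
      \<open>d\<close>.\<close>
    define c where "c = x \<otimes> s \<oplus> y \<otimes> t"
    have c: "c \<in> M" "c \<in> carrier R"
      using 3 xy s t by (auto simp: c_def intro: M.I_l_closed M.a_closed)
    have "\<one> \<ominus> c \<notin> M"
    proof
      assume "\<one> \<ominus> c \<in> M"
      then have "(\<one> \<ominus> c) \<oplus> c \<in> M" using c M.a_closed by blast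
      moreover have "(\<one> \<ominus> c) \<oplus> c = \<one>" using c by algebra
      ultimately show False using M.one_imp_carrier M.I_notcarr by auto
    qed
    then obtain z where z: "z \<in> carrier R" "z \<otimes> (\<one> \<ominus> c) = \<one>"
      using unit c by blast
    have "c \<otimes> d = d" using xy s t d unfolding c_def
      by (metis (no_types, lifting) l_distr m_assoc m_closed)
    then have "(\<one> \<ominus> c) \<otimes> d = \<zero>" using c d by algebra
    then have "d = \<zero>" using z d c by (metis l_one m_assoc minus_closed one_closed r_null)
    then show ?thesis using s t cgenideal_self by auto
  qed
qed

text \<open>Of two nonzero elements, one from each ideal, one divides the other; the multiple is
  then a nonzero common element.\<close>

lemma (in cring) local_principal_ideals_meet:
  assumes "local_ring R" and "principal_ideal_ring R" and "finite {I. ideal I R}"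
    and I: "ideal I R" "I \<noteq> {\<zero>}" and J: "ideal J R" "J \<noteq> {\<zero>}"
  shows "I \<inter> J \<noteq> {\<zero>}"
proof -
  interpret I: ideal I R by fact
  interpret J: ideal J R by fact
  obtain a b where ab: "a \<in> I" "a \<noteq> \<zero>" "b \<in> J" "b \<noteq> \<zero>"
    using I J I.zero_closed J.zero_closed by blast
  then have "a \<in> J \<or> b \<in> I"
    using local_principal_divides[OF assms(1-3), of a b] cgenideal_minimal[of I a]
      cgenideal_minimal[of J b] I J I.Icarr J.Icarr by blast
  with ab show ?thesis by blast
qed

lemma local_ring_nontrivial:
  fixes R (structure)
  assumes "local_ring R"
  shows "\<one> \<noteq> \<zero>"
    and "\<not> field R \<Longrightarrow> nontrivial_ideals R \<noteq> {}"
proof -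
  interpret cring R using assms by (simp add: local_ring_def)
  obtain M where "maximalideal M R"
    using assms unfolding local_ring_def by blast
  interpret M: maximalideal M R by fact
  show "\<one> \<noteq> \<zero>"
    using M.zero_closed M.one_imp_carrier M.I_notcarr by auto
  \<comment> \<open>The maximal ideal itself is the witness: if it were zero, the ring would be a
    field.\<close>
  show "nontrivial_ideals R \<noteq> {}" if "\<not> field R"
    using that zeromaximalideal_fieldI M.is_maximalideal M.is_ideal M.I_notcarr
    unfolding nontrivial_ideals_def by blast
qed

lemma (in ring) card_nontrivial_ideals:
  assumes "finite {I. ideal I R}" and "\<one> \<noteq> \<zero>"
  shows "card {I. ideal I R} = card (nontrivial_ideals R) + 2"
proof -
  have eq: "nontrivial_ideals R = {I. ideal I R} - {{\<zero>}, carrier R}"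
    by (auto simp: nontrivial_ideals_def)
  have "{{\<zero>}, carrier R} \<subseteq> {I. ideal I R}" using zeroideal oneideal by blast
  \<comment> \<open>The two trivial ideals are distinct because the ring is not the zero
    ring.\<close>
  moreover have "card {{\<zero>}, carrier R} = 2"
    using assms(2) one_closed by (metis card_2_iff singletonD)
  ultimately show ?thesis
    using assms(1) card_mono[OF assms(1), of "{{\<zero>}, carrier R}"]
    unfolding eq by (simp add: card_Diff_subset)
qed

section \<open>Ideals of a finite product of rings\<close>

lemma (in cring) ideal_criterion:
  assumes sub: "I \<subseteq> carrier R" and zero: "\<zero> \<in> I"
    and add: "\<And>a b. a \<in> I \<Longrightarrow> b \<in> I \<Longrightarrow> a \<oplus> b \<in> I"
    and mult: "\<And>a x. a \<in> I \<Longrightarrow> x \<in> carrier R \<Longrightarrow> x \<otimes> a \<in> I"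
  shows "ideal I R"
proof (rule idealI)
  show "subgroup I (add_monoid R)"
  proof (rule add.subgroupI)
    \<comment> \<open>Negation is multiplication by -1, so absorption covers it.\<close>
    show "\<ominus> a \<in> I" if "a \<in> I" for a
      using mult[OF that, of "\<ominus> \<one>"] that sub by (auto simp: l_minus)
  qed (use assms in auto)
  show "a \<otimes> x \<in> I" if "a \<in> I" "x \<in> carrier R" for a x
    using mult[OF that] that sub m_comm[of a x] by auto
qed (use assms ring_axioms in auto)

lemma RDirProd_list_nth_hom:
  assumes "i < length Rs"
  shows "(\<lambda>x. x ! i) \<in> ring_hom (RDirProd_list Rs) (Rs ! i)"
  using assms
proof (induction Rs arbitrary: i)
  case (Cons R Rs)
  let ?P = "RDirProd_list Rs"
  let ?Q = "RDirProd_list (R # Rs)"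
  \<comment> \<open>The operations of the list product are reached by transporting those of the
    binary product along this homomorphism.\<close>
  have cons: "(\<lambda>(a, as). a # as) \<in> ring_hom (RDirProd R ?P) ?Q"
    by (rule RDirProd_list_hom1)
  have carr: "\<exists>a as. x = a # as \<and> a \<in> carrier R \<and> as \<in> carrier ?P" if "x \<in> carrier ?Q" for x
    using that unfolding RDirProd_list_carrier by auto
  have pair: "(a, as) \<in> carrier (RDirProd R ?P)" if "a \<in> carrier R" "as \<in> carrier ?P" for a as
    using that by (simp add: RDirProd_carrier)
  have mult: "(a # as) \<otimes>\<^bsub>?Q\<^esub> (b # bs) = (a \<otimes>\<^bsub>R\<^esub> b) # (as \<otimes>\<^bsub>?P\<^esub> bs)"
    if "a \<in> carrier R" "as \<in> carrier ?P" "b \<in> carrier R" "bs \<in> carrier ?P" for a as b bs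
    using ring_hom_mult[OF cons pair[OF that(1,2)] pair[OF that(3,4)]]
    by (simp add: RDirProd_def DirProd_def monoid.defs)
  have add: "(a # as) \<oplus>\<^bsub>?Q\<^esub> (b # bs) = (a \<oplus>\<^bsub>R\<^esub> b) # (as \<oplus>\<^bsub>?P\<^esub> bs)"
    if "a \<in> carrier R" "as \<in> carrier ?P" "b \<in> carrier R" "bs \<in> carrier ?P" for a as b bs
    using ring_hom_add[OF cons pair[OF that(1,2)] pair[OF that(3,4)]]
    by (simp add: RDirProd_def DirProd_def monoid.defs)
  have one: "\<one>\<^bsub>?Q\<^esub> = \<one>\<^bsub>R\<^esub> # \<one>\<^bsub>?P\<^esub>"
    by (simp add: RDirProd_list_one)
  show ?case
  proof (cases i)
    case 0
    then show ?thesis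
      by (intro ring_hom_memI) (auto dest!: carr simp: mult add one)
  next
    case (Suc j)
    with Cons have hom: "(\<lambda>x. x ! j) \<in> ring_hom ?P (Rs ! j)" by simp
    with Suc show ?thesis
      by (intro ring_hom_memI)
        (auto dest!: carr simp: mult add one ring_hom_memE[OF hom])
  qed
qed simp

text \<open>The product is characterised by its projections: homomorphisms that are jointly
  injective and jointly surjective. This separates the study of ideals from the isomorphism and from
  the encoding by lists.\<close>

locale ring_product = R: cring R for R (structure) +
  fixes A :: "'i set" and S :: "'i \<Rightarrow> ('r, 's) ring_scheme" and proj :: "'i \<Rightarrow> 'a \<Rightarrow> 'r"
  assumes finite_index: "finite A"
    and cring_factor: "i \<in> A \<Longrightarrow> cring (S i)"
    and proj_hom: "i \<in> A \<Longrightarrow> proj i \<in> ring_hom R (S i)"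
    and proj_inj: "x \<in> carrier R \<Longrightarrow> y \<in> carrier R \<Longrightarrow> (\<And>i. i \<in> A \<Longrightarrow> proj i x = proj i y) \<Longrightarrow> x = y"
    and proj_surj: "(\<And>i. i \<in> A \<Longrightarrow> f i \<in> carrier (S i)) \<Longrightarrow>
      \<exists>x\<in>carrier R. \<forall>i\<in>A. proj i x = f i"
begin

lemmas proj_simps = ring_hom_memE[OF proj_hom]

lemma proj_zero: "i \<in> A \<Longrightarrow> proj i \<zero> = \<zero>\<^bsub>S i\<^esub>"
  using ring_hom_zero[OF proj_hom] R.ring_axioms cring_factor cring.axioms(1) by blast

lemma exists_supported_at:
  assumes "j \<in> A" and "c \<in> carrier (S j)"
  shows "\<exists>x\<in>carrier R. proj j x = c \<and> (\<forall>i\<in>A. i \<noteq> j \<longrightarrow> proj i x = \<zero>\<^bsub>S i\<^esub>)"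
proof -
  have "\<exists>x\<in>carrier R. \<forall>i\<in>A. proj i x = (if i = j then c else \<zero>\<^bsub>S i\<^esub>)"
    using assms cring_factor by (intro proj_surj) (auto intro: ring.ring_simprules(2) cring.axioms(1))
  then show ?thesis using assms by force
qed

definition prod_ideal :: "('i \<Rightarrow> 'r set) \<Rightarrow> 'a set" where
  "prod_ideal f = {x \<in> carrier R. \<forall>i\<in>A. proj i x \<in> f i}"

lemma ideal_prod_ideal:
  assumes "\<And>i. i \<in> A \<Longrightarrow> ideal (f i) (S i)"
  shows "ideal (prod_ideal f) R"
proof (rule R.ideal_criterion)
  note f = ideal.axioms(1)[OF assms]
  show "\<zero> \<in> prod_ideal f"
    using additive_subgroup.zero_closed[OF f] by (auto simp: prod_ideal_def proj_zero)
  show "a \<oplus> b \<in> prod_ideal f" if "a \<in> prod_ideal f" "b \<in> prod_ideal f" for a b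
    using that additive_subgroup.a_closed[OF f] by (auto simp: prod_ideal_def proj_simps)
  show "x \<otimes> a \<in> prod_ideal f" if "a \<in> prod_ideal f" "x \<in> carrier R" for a x
    using that ideal.I_l_closed[OF assms] by (auto simp: prod_ideal_def proj_simps)
qed (auto simp: prod_ideal_def)

lemma ideal_proj_image:
  assumes "ideal I R" and "i \<in> A"
  shows "ideal (proj i ` I) (S i)"
proof -
  interpret I: ideal I R by fact
  interpret Si: cring "S i" using assms cring_factor by blast
  show ?thesis
  proof (rule Si.ideal_criterion)
    show "proj i ` I \<subseteq> carrier (S i)"
      using assms I.Icarr proj_simps(1) by blast
    show "\<zero>\<^bsub>S i\<^esub> \<in> proj i ` I"
      using assms I.zero_closed proj_zero by (metis image_eqI)
    show "a \<oplus>\<^bsub>S i\<^esub> b \<in> proj i ` I" if ab: "a \<in> proj i ` I" "b \<in> proj i ` I" for a b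
    proof -
      obtain x y where "x \<in> I" "y \<in> I" "a = proj i x" "b = proj i y" using ab by blast
      then show ?thesis
        using assms(2) by (intro image_eqI[of _ _ "x \<oplus> y"]) (auto simp: proj_simps I.Icarr)
    qed
    show "c \<otimes>\<^bsub>S i\<^esub> a \<in> proj i ` I" if ac: "a \<in> proj i ` I" "c \<in> carrier (S i)" for a c
    proof -
      obtain x where "x \<in> I" "a = proj i x" using ac by blast
      moreover obtain y where "y \<in> carrier R" "proj i y = c"
        using exists_supported_at assms(2) ac by blast
      ultimately show ?thesis
        using assms(2) by (intro image_eqI[of _ _ "y \<otimes> x"]) (auto simp: proj_simps I.Icarr I.I_l_closed)
    qed
  qed
qed

text \<open>Membership of each coordinate in the image of \<open>I\<close> may be witnessed by a
  different element of \<open>I\<close> for each coordinate. Multiplying by the idempotents of the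
  factors and adding glues these witnesses into one element of \<open>I\<close>.\<close>

lemma prod_ideal_proj_image:
  assumes "ideal I R"
  shows "prod_ideal (\<lambda>i. proj i ` I) = I"
proof
  interpret I: ideal I R by fact
  show "I \<subseteq> prod_ideal (\<lambda>i. proj i ` I)"
    using I.Icarr by (auto simp: prod_ideal_def)
  show "prod_ideal (\<lambda>i. proj i ` I) \<subseteq> I"
  proof
    fix x assume "x \<in> prod_ideal (\<lambda>i. proj i ` I)"
    then have x: "x \<in> carrier R" "\<And>i. i \<in> A \<Longrightarrow> proj i x \<in> proj i ` I"
      by (auto simp: prod_ideal_def)
    have "\<exists>y\<in>I. (\<forall>i\<in>B. proj i y = proj i x) \<and> (\<forall>i\<in>A - B. proj i y = \<zero>\<^bsub>S i\<^esub>)"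
      if "B \<subseteq> A" for B
      using finite_subset[OF that finite_index] that
    proof (induction B rule: finite_induct)
      case empty
      show ?case using proj_zero by (intro bexI[OF _ I.zero_closed]) auto
    next
      case (insert j B)
      then obtain y where y: "y \<in> I" "\<forall>i\<in>B. proj i y = proj i x" "\<forall>i\<in>A - B. proj i y = \<zero>\<^bsub>S i\<^esub>"
        by auto
      have j: "j \<in> A" using insert by auto
      then obtain z where z: "z \<in> I" "proj j z = proj j x" using x by (metis imageE)
      interpret Sj: cring "S j" using j cring_factor by blast
      \<comment> \<open>This is the idempotent of factor \<open>j\<close>: the product of
        \<open>e\<close> and \<open>z\<close> has the \<open>j\<close>-th coordinate of
        \<open>x\<close> and vanishes elsewhere, while \<open>y\<close> vanishes at
        \<open>j\<close>.\<close>
      obtain e where e: "e \<in> carrier R" "proj j e = \<one>\<^bsub>S j\<^esub>"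
        "\<And>i. i \<in> A \<Longrightarrow> i \<noteq> j \<Longrightarrow> proj i e = \<zero>\<^bsub>S i\<^esub>"
        using exists_supported_at[OF j Sj.one_closed] by blast
      let ?w = "y \<oplus> e \<otimes> z"
      have "?w \<in> I" using y z e I.I_l_closed by auto
      moreover have w: "proj i ?w = (if i = j then proj i x else proj i y)" if "i \<in> A" for i
      proof -
        interpret Si: cring "S i" using that cring_factor by blast
        have "proj i ?w = proj i y \<oplus>\<^bsub>S i\<^esub> proj i e \<otimes>\<^bsub>S i\<^esub> proj i z"
          using that y z e by (simp add: proj_simps I.Icarr)
        moreover have "proj i y \<in> carrier (S i)" "proj i z \<in> carrier (S i)"
          using that y z by (auto simp: proj_simps I.Icarr)
        ultimately show ?thesis
          using that e z y insert.hyps j by (cases "i = j") auto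
      qed
      ultimately show ?case
        using y insert.prems insert.hyps by (intro bexI[of _ ?w]) (auto simp: subset_eq)
    qed
    from this[of A] obtain y where "y \<in> I" "\<forall>i\<in>A. proj i y = proj i x" by auto
    then show "x \<in> I" using proj_inj[of y x] x I.Icarr by auto
  qed
qed

lemma proj_image_prod_ideal:
  assumes f: "\<And>i. i \<in> A \<Longrightarrow> ideal (f i) (S i)" and j: "j \<in> A"
  shows "proj j ` prod_ideal f = f j"
proof
  show "f j \<subseteq> proj j ` prod_ideal f"
  proof
    fix c assume c: "c \<in> f j"
    then have "c \<in> carrier (S j)" using ideal.Icarr f j by metis
    then obtain x where "x \<in> carrier R" "proj j x = c" "\<forall>i\<in>A. i \<noteq> j \<longrightarrow> proj i x = \<zero>\<^bsub>S i\<^esub>"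
      using exists_supported_at j by blast
    moreover from this have "x \<in> prod_ideal f"
      using c additive_subgroup.zero_closed[OF ideal.axioms(1)[OF f]] by (force simp: prod_ideal_def)
    ultimately show "c \<in> proj j ` prod_ideal f" by blast
  qed
qed (use j in \<open>auto simp: prod_ideal_def\<close>)

text \<open>Families of ideals are taken as extensional functions, so that values outside
  \<open>A\<close> do not spoil injectivity and the product formula for cardinalities
  applies.\<close>

lemma bij_betw_prod_ideal:
  "bij_betw prod_ideal (\<Pi>\<^sub>E i\<in>A. {J. ideal J (S i)}) {I. ideal I R}"
proof (rule bij_betw_byWitness[where f' = "\<lambda>I. \<lambda>i\<in>A. proj i ` I"])
  show "\<forall>f\<in>\<Pi>\<^sub>E i\<in>A. {J. ideal J (S i)}. (\<lambda>i\<in>A. proj i ` prod_ideal f) = f"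
    by (auto simp: fun_eq_iff PiE_iff extensional_def proj_image_prod_ideal)
  have "prod_ideal (\<lambda>i\<in>A. proj i ` I) = prod_ideal (\<lambda>i. proj i ` I)" for I
    by (auto simp: prod_ideal_def)
  then show "\<forall>I\<in>{I. ideal I R}. prod_ideal (\<lambda>i\<in>A. proj i ` I) = I"
    by (simp add: prod_ideal_proj_image)
  show "prod_ideal ` (\<Pi>\<^sub>E i\<in>A. {J. ideal J (S i)}) \<subseteq> {I. ideal I R}"
    by (auto intro: ideal_prod_ideal)
  show "(\<lambda>I. \<lambda>i\<in>A. proj i ` I) ` {I. ideal I R} \<subseteq> (\<Pi>\<^sub>E i\<in>A. {J. ideal J (S i)})"
    by (auto intro: ideal_proj_image)
qed

lemma card_ideals: "card {I. ideal I R} = (\<Prod>i\<in>A. card {J. ideal J (S i)})"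
  using bij_betw_same_card[OF bij_betw_prod_ideal] finite_index by (simp add: card_PiE)

lemma finite_ideals:
  assumes "\<And>i. i \<in> A \<Longrightarrow> finite {J. ideal J (S i)}"
  shows "finite {I. ideal I R}"
  using bij_betw_finite[OF bij_betw_prod_ideal] finite_index assms by (simp add: finite_PiE)

lemma proj_image_carrier: "i \<in> A \<Longrightarrow> proj i ` carrier R = carrier (S i)"
  using exists_supported_at proj_simps(1) by fast

definition support :: "'a set \<Rightarrow> 'i set" where
  "support I = {i \<in> A. proj i ` I \<noteq> {\<zero>\<^bsub>S i\<^esub>}}"

lemma support_prod_ideal:
  assumes "\<And>i. i \<in> A \<Longrightarrow> ideal (f i) (S i)"
  shows "support (prod_ideal f) = {i \<in> A. f i \<noteq> {\<zero>\<^bsub>S i\<^esub>}}"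
  unfolding support_def using proj_image_prod_ideal[OF assms] by blast

lemma support_empty_iff:
  assumes "ideal I R"
  shows "support I = {} \<longleftrightarrow> I = {\<zero>}"
proof
  interpret I: ideal I R by fact
  assume "support I = {}"
  then have image: "proj i ` I = {\<zero>\<^bsub>S i\<^esub>}" if "i \<in> A" for i
    using that by (simp add: support_def)
  have "proj i x = proj i \<zero>" if "x \<in> I" "i \<in> A" for x i
    using imageI[OF that(1), of "proj i"] image[OF that(2)] proj_zero[OF that(2)] by simp
  then have "x = \<zero>" if "x \<in> I" for x
    using that I.Icarr proj_inj[of x \<zero>] R.zero_closed by blast
  then show "I = {\<zero>}" using I.zero_closed by blast
qed (auto simp: support_def proj_zero)

lemma prod_ideal_nontrivial:
  assumes f: "\<And>i. i \<in> A \<Longrightarrow> ideal (f i) (S i)"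
    and "i \<in> A" "f i \<noteq> {\<zero>\<^bsub>S i\<^esub>}" and "j \<in> A" "f j \<noteq> carrier (S j)"
  shows "prod_ideal f \<in> nontrivial_ideals R"
proof -
  have "support (prod_ideal f) \<noteq> {}"
    using assms by (auto simp: support_prod_ideal)
  moreover have "prod_ideal f \<noteq> carrier R"
    using proj_image_prod_ideal[OF f \<open>j \<in> A\<close>] proj_image_carrier[OF \<open>j \<in> A\<close>] assms(5) by auto
  ultimately show ?thesis
    using ideal_prod_ideal[OF f] support_empty_iff by (simp add: nontrivial_ideals_def)
qed

text \<open>The intersection is the product ideal of the componentwise intersections. By
  \<open>meet\<close>, such a component is nonzero exactly where both components are.\<close>

lemma inter_nonzero_iff_support:
  assumes I: "ideal I R" and J: "ideal J R"
    and meet: "\<And>i K L. i \<in> A \<Longrightarrow> ideal K (S i) \<Longrightarrow> K \<noteq> {\<zero>\<^bsub>S i\<^esub>} \<Longrightarrow> ideal L (S i) \<Longrightarrow>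
      L \<noteq> {\<zero>\<^bsub>S i\<^esub>} \<Longrightarrow> K \<inter> L \<noteq> {\<zero>\<^bsub>S i\<^esub>}"
  shows "I \<inter> J \<noteq> {\<zero>} \<longleftrightarrow> support I \<inter> support J \<noteq> {}"
proof -
  have eq: "I \<inter> J = prod_ideal (\<lambda>i. proj i ` I \<inter> proj i ` J)"
    using prod_ideal_proj_image[OF I] prod_ideal_proj_image[OF J] by (auto simp: prod_ideal_def)
  have "support (I \<inter> J) = {i \<in> A. proj i ` I \<inter> proj i ` J \<noteq> {\<zero>\<^bsub>S i\<^esub>}}"
    unfolding eq using I J cring_factor
    by (intro support_prod_ideal) (auto intro!: ring.i_intersect ideal_proj_image cring.axioms(1))
  also have "\<dots> = support I \<inter> support J"
  proof -
    have "proj i ` I \<inter> proj i ` J \<noteq> {\<zero>\<^bsub>S i\<^esub>} \<longleftrightarrow>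
        proj i ` I \<noteq> {\<zero>\<^bsub>S i\<^esub>} \<and> proj i ` J \<noteq> {\<zero>\<^bsub>S i\<^esub>}" if i: "i \<in> A" for i
    proof -
      have "\<zero>\<^bsub>S i\<^esub> \<in> proj i ` I" "\<zero>\<^bsub>S i\<^esub> \<in> proj i ` J"
        using ideal_proj_image[OF I i] ideal_proj_image[OF J i]
        by (auto dest: ideal.axioms(1) additive_subgroup.zero_closed)
      then show ?thesis
        using meet[OF i ideal_proj_image[OF I i] _ ideal_proj_image[OF J i]] by auto
    qed
    then show ?thesis by (auto simp: support_def)
  qed
  finally show ?thesis
    using support_empty_iff[OF R.i_intersect[OF I J]] by simp
qed

end

section \<open>From the list product to projections, and the final count\<close>

lemma ring_product_of_iso:
  assumes "cring R" and iso: "R \<simeq> RDirProd_list (map S [1..<m + 1])"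
    and "\<And>i. i \<in> {1..m} \<Longrightarrow> cring (S i)"
  shows "\<exists>proj. ring_product R {1..m} S proj"
proof -
  let ?P = "RDirProd_list (map S [1..<m + 1])"
  obtain h where h: "h \<in> ring_hom R ?P" "bij_betw h (carrier R) (carrier ?P)"
    using iso unfolding is_ring_iso_def ring_iso_def by blast
  \<comment> \<open>Factors are numbered from 1 but list positions from 0, hence the shift by
    one.\<close>
  have nth: "map S [1..<m + 1] ! (i - 1) = S i" "i - 1 < m" if "i \<in> {1..m}" for i
    using that by (auto simp del: upt_Suc)
  have len: "length (h x) = m" if "x \<in> carrier R" for x
    using RDirProd_list_carrier_mem(1)[OF ring_hom_closed[OF h(1) that]] by simp
  have "ring_product R {1..m} S (\<lambda>i x. h x ! (i - 1))"
  proof (intro ring_product.intro ring_product_axioms.intro)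
    show "(\<lambda>x. h x ! (i - 1)) \<in> ring_hom R (S i)" if "i \<in> {1..m}" for i
      using ring_hom_trans[OF h(1) RDirProd_list_nth_hom[of "i - 1"]] nth[OF that]
      by (simp add: comp_def)
    show "x = y" if "x \<in> carrier R" "y \<in> carrier R"
      and eq: "\<And>i. i \<in> {1..m} \<Longrightarrow> h x ! (i - 1) = h y ! (i - 1)" for x y
    proof -
      have "h x = h y"
      proof (rule nth_equalityI)
        show "h x ! k = h y ! k" if "k < length (h x)" for k
          using eq[of "Suc k"] that len[OF \<open>x \<in> carrier R\<close>] by simp
      qed (use len that in simp)
      then show ?thesis using h(2) that by (auto simp: bij_betw_def dest: inj_onD)
    qed
    show "\<exists>x\<in>carrier R. \<forall>i\<in>{1..m}. h x ! (i - 1) = f i"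
      if f: "\<And>i. i \<in> {1..m} \<Longrightarrow> f i \<in> carrier (S i)" for f
    proof -
      have "map f [1..<m + 1] \<in> carrier ?P"
        using f by (intro RDirProd_list_carrier_memI) (auto simp del: upt_Suc)
      then obtain x where "x \<in> carrier R" "h x = map f [1..<m + 1]"
        using bij_betw_imp_surj_on[OF h(2)] by (metis imageE)
      then show ?thesis by (intro bexI[of _ x]) (auto simp del: upt_Suc)
    qed
  qed (use assms in auto)
  then show ?thesis by blast
qed

theorem theorem3p6:
  fixes m :: nat
    and R :: "('a, 'c) ring_scheme"
    and S :: "nat \<Rightarrow> ('b, 'd) ring_scheme"
    and n :: "nat \<Rightarrow> nat"
  assumes "m \<ge> 2"
    and "cring R"
    and "R \<simeq> RDirProd_list (map S [1..<m + 1])"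
    and "\<And>i. i \<in> {1..m} \<Longrightarrow> local_ring (S i)"
    and "\<And>i. i \<in> {1..m} \<Longrightarrow> principal_ideal_ring (S i)"
    and "\<And>i. i \<in> {1..m} \<Longrightarrow> finite {I. ideal I (S i)}"
    and "\<And>i. i \<in> {1..m} \<Longrightarrow> \<not> field (S i)"
    and "\<And>i. i \<in> {1..m} \<Longrightarrow> n i = card (nontrivial_ideals (S i))"
  shows "int (sdim (intersection_graph R)) = (\<Prod>i = 1..m. (int (n i) + 2)) - 2 ^ (m - 1) - 2"
proof -
  let ?A = "{1..m}"
  have cring_S: "cring (S i)" if "i \<in> ?A" for i
    using assms(4)[OF that] by (simp add: local_ring_def)
  obtain proj where "ring_product R ?A S proj"
    using ring_product_of_iso[OF assms(2,3) cring_S] by blast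
  then interpret ring_product R ?A S proj .
  have ring_S: "ring (S i)" if "i \<in> ?A" for i
    using cring_S[OF that] by (rule cring.axioms(1))
  note one_S = local_ring_nontrivial(1)[OF assms(4)]
  have zero_carrier: "{\<zero>\<^bsub>S i\<^esub>} \<noteq> carrier (S i)" if "i \<in> ?A" for i
    using one_S[OF that] ring.ring_simprules(6)[OF ring_S[OF that]] by auto
  have "\<forall>i\<in>?A. \<exists>J. J \<in> nontrivial_ideals (S i)"
    using local_ring_nontrivial(2)[OF assms(4) assms(7)] by blast
  then obtain K where K: "\<forall>i\<in>?A. K i \<in> nontrivial_ideals (S i)"
    by (rule bchoice[THEN exE])
  then have K_ideal: "ideal (K i) (S i)" and K_zero: "K i \<noteq> {\<zero>\<^bsub>S i\<^esub>}"
    and K_carrier: "K i \<noteq> carrier (S i)" if "i \<in> ?A" for i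
    using that by (auto simp: nontrivial_ideals_def)
  \<comment> \<open>This ideal realises the support \<open>B\<close>. Using \<open>K i\<close>
    instead of the whole factor keeps it proper even when \<open>B\<close> is the full index
    set.\<close>
  define u where "u B = prod_ideal (\<lambda>i. if i \<in> B then K i else {\<zero>\<^bsub>S i\<^esub>})" for B
  have u_ideal: "ideal (if i \<in> B then K i else {\<zero>\<^bsub>S i\<^esub>}) (S i)" if "i \<in> ?A" for i B
    using K_ideal that ring.zeroideal[OF ring_S] by simp
  have u_verts: "u B \<in> nontrivial_ideals R" if B: "B \<subseteq> ?A" "B \<noteq> {}" for B
  proof -
    \<comment> \<open>Since \<open>K i\<close> is both nonzero and proper, a single index shows that
      the product ideal is nonzero and proper.\<close>
    obtain i where "i \<in> B" "i \<in> ?A" using B by blast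
    then show ?thesis
      unfolding u_def using K_zero K_carrier u_ideal
      by (intro prod_ideal_nontrivial[of _ i i]) simp_all
  qed
  have u_support: "support (u B) = B" if "B \<subseteq> ?A" for B
    unfolding u_def using support_prod_ideal[OF u_ideal] K_zero that by auto
  have fin: "finite {I. ideal I R}" using finite_ideals assms(6) by blast
  interpret support_graph "intersection_graph R" support ?A
  proof
    show "finite (verts (intersection_graph R))"
      using fin by (rule rev_finite_subset) (auto simp: intersection_graph_def nontrivial_ideals_def)
    have "I \<inter> J \<noteq> {\<zero>\<^bsub>R\<^esub>} \<longleftrightarrow> support I \<inter> support J \<noteq> {}"
      if "I \<in> nontrivial_ideals R" "J \<in> nontrivial_ideals R" for I J
      using that cring.local_principal_ideals_meet[OF cring_S assms(4-6)]
      by (intro inter_nonzero_iff_support) (auto simp: nontrivial_ideals_def)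
    then show "arcs (intersection_graph R) = {(I, J). I \<in> verts (intersection_graph R) \<and>
        J \<in> verts (intersection_graph R) \<and> I \<noteq> J \<and> support I \<inter> support J \<noteq> {}}"
      by (auto simp: intersection_graph_def)
    show "support I \<subseteq> ?A" for I
      unfolding support_def by blast
    show "support I \<noteq> {}" if "I \<in> verts (intersection_graph R)" for I
      using that support_empty_iff[of I] by (simp add: intersection_graph_def nontrivial_ideals_def)
    show "\<exists>I\<in>verts (intersection_graph R). support I = B" if "B \<subseteq> ?A" "B \<noteq> {}" for B
      using u_verts[OF that] u_support[OF that(1)] by (auto simp: intersection_graph_def)
    show "\<exists>I\<in>verts (intersection_graph R). \<exists>J\<in>verts (intersection_graph R).
        I \<noteq> J \<and> support I = {i} \<and> support J = {i}" if i: "i \<in> ?A" for i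
    proof -
      \<comment> \<open>A second ideal of support \<open>{i}\<close> takes the whole factor
        \<open>i\<close>. It is proper because a different index exists, and its \<open>i\<close>-th
        projection distinguishes it from \<open>u {i}\<close>.\<close>
      let ?f = "\<lambda>j. if j = i then carrier (S j) else {\<zero>\<^bsub>S j\<^esub>}"
      have f: "ideal (?f j) (S j)" if "j \<in> ?A" for j
        using ring.zeroideal[OF ring_S[OF that]] ring.oneideal[OF ring_S[OF that]] by auto
      define j :: nat where "j = (if i = 1 then 2 else 1)"
      have j: "j \<in> ?A" "j \<noteq> i" using \<open>m \<ge> 2\<close> by (auto simp: j_def)
      have nontriv: "prod_ideal ?f \<in> nontrivial_ideals R"
        using prod_ideal_nontrivial[of ?f i j] f i j zero_carrier by fastforce
      have supp: "support (prod_ideal ?f) = {i}"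
        using support_prod_ideal[OF f] zero_carrier[OF i] i by auto
      have "proj i ` prod_ideal ?f = carrier (S i)"
        by (subst proj_image_prod_ideal) (use f i in simp_all)
      moreover have "proj i ` u {i} = K i"
        unfolding u_def by (subst proj_image_prod_ideal) (use K_ideal ring.zeroideal[OF ring_S] i in simp_all)
      ultimately have "u {i} \<noteq> prod_ideal ?f" using K_carrier[OF i] by auto
      then show ?thesis
        using nontriv supp u_verts[of "{i}"] u_support[of "{i}"] i
        by (intro bexI[of _ "u {i}"] bexI[of _ "prod_ideal ?f"])
          (auto simp: intersection_graph_def)
    qed
  qed (use \<open>m \<ge> 2\<close> in \<open>auto simp: intersection_graph_def\<close>)
  \<comment> \<open>The first projection carries this inequality over from a factor; it makes the
    two trivial ideals of \<open>R\<close> distinct.\<close>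
  have "\<one>\<^bsub>R\<^esub> \<noteq> \<zero>\<^bsub>R\<^esub>"
    using one_S[of 1] proj_simps(4)[of 1] proj_zero[of 1] \<open>m \<ge> 2\<close> by auto
  then have "card (verts (intersection_graph R)) + 2 = card {I. ideal I R}"
    using R.card_nontrivial_ideals fin by (simp add: intersection_graph_def)
  also have "\<dots> = (\<Prod>i\<in>?A. n i + 2)"
    unfolding card_ideals
    using ring.card_nontrivial_ideals[OF ring_S assms(6) one_S] assms(8) by (intro prod.cong) auto
  finally have "sdim (intersection_graph R) + 2 ^ (m - 1) + 2 = (\<Prod>i\<in>?A. n i + 2)"
    using sdim_support_graph by simp
  \<comment> \<open>The identity is transferred to the integers in additive form, so the
    subtractions in the goal are genuine.\<close>
  then have "int (sdim (intersection_graph R) + 2 ^ (m - 1) + 2) = int (\<Prod>i\<in>?A. n i + 2)"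
    by (rule arg_cong)
  then show ?thesis by (simp add: algebra_simps)
qed

end
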